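(* Let $D\subseteq\mathbb{R}^l$ be non-empty, $U\subseteq\mathbb{R}^m$, and let $f:D\times\mathbb{R}^n\times U\to\mathbb{R}^n$ satisfy the standing assumptions (H1) and (H2) listed in the context. Consider the control system $\dot x(t)=f(d(t),x(t),u(t))$ with $d(t)\in D$, $x(t)\in\mathbb{R}^n$, $u(t)\in U$. Suppose that there exist a set $\Omega\subseteq\mathbb{R}^n$, a continuously differentiable function $V:\mathbb{R}^n\to\mathbb{R}$ and constants $v\in U$, $R\ge0$, $\delta>0$ such that $$\sup_{d\in D}\nabla V(x)f(d,x,v)\le-\delta\quad\text{for all }x\in\Omega\text{ with }V(x)\ge R.$$ Moreover, suppose that there exist functions $a_1,a_2\in K_\infty$ and a constant $p>0$ such that for every $x_0\in\Omega$ and $d\in L^\infty_{loc}(\mathbb{R}^+;D)$ the solution $x(t)$ of $\dot x=f(d,x,u)$ with $u(t)\equiv v$ and initial condition $x(0)=x_0$ exists for all $t\ge0$ and satisfies $x(t)\in\Omega$ and $a_1(|x(t)|)\le\exp(pt)\,a_2(|x_0|)$ for all $t\ge0$. Then for every $r>0$ the set $A:=\Omega\cap\{x\in\mathbb{R}^n:V(x)\le R\}$ is $r$-robustly reachable from $\Omega$ for the system $\dot x=f(d,x,u)$ with constant control.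
   Context: Notation. $\mathbb{R}^+=[0,+\infty)$; $|\cdot|$ is the Euclidean norm; $x'$ is the transpose of $x$; $\nabla V(x)$ is the gradient of $V$ at $x$ as a row vector. $L^\infty_{loc}(\mathbb{R}^+;D)$ is the class of Lebesgue measurable, locally essentially bounded maps $d:\mathbb{R}^+\to D$. Class $N$: non-decreasing continuous $\gamma:\mathbb{R}^+\to\mathbb{R}^+$ with $\gamma(0)=0$. $K_\infty$: continuous, strictly increasing, unbounded $\gamma:\mathbb{R}^+\to\mathbb{R}^+$ with $\gamma(0)=0$. Solutions are absolutely continuous functions satisfying the differential equation almost everywhere. Standing assumptions. (H1) $f$ is continuous on $D\times\mathbb{R}^n\times U$ and for every bounded $S\subset\mathbb{R}^n\times U$ there exists $L\ge0$ such that $(x-y)'(f(d,x,u)-f(d,y,u))\le L|x-y|^2$ for all $d\in D$ and all $(x,u)\in S$, $(y,u)\in S$. (H2) There exists $a\in K_\infty$ such that $|f(d,x,u)|\le a(|x|+|u|)$ for all $(u,d,x)\in U\times D\times\mathbb{R}^n$. Robust reachability. Let $r>0$. A set $A\subseteq\mathbb{R}^n$ is $r$-robustly reachable from a set $\Omega\subseteq\mathbb{R}^n$ for $\dot x=f(d,x,u)$ with constant control if there exist $v\in U$, $c\ge0$ and functions $a,b\in N$ such that: for every $x_0\in\Omega$ and $d\in L^\infty_{loc}(\mathbb{R}^+;D)$ there exists $T(d,x_0)\in[0,c+b(|x_0|)]$ such that the solution $x(t)$ of $\dot x=f(d,x,u)$ with $u(t)\equiv v$ and $x(0)=x_0$ exists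 for all $t\in[0,T(d,x_0)+r]$ and satisfies: (i) $|x(t)|\le a(|x_0|)$ for all $t\in[0,T(d,x_0)+r]$; (ii) $x(t)\in A$ for all $t\in[T(d,x_0),T(d,x_0)+r]$; (iii) $x(t)\in\Omega$ for all $t\in[0,T(d,x_0)]$. *)

theory Defs
  imports "HOL-Analysis.Analysis"
begin

text \<open>Maps on the half-line $[0,\infty)$ are total functions on the reals of which only the
  restriction to \<open>{0..}\<close> matters.\<close>

definition class_N :: "(real \<Rightarrow> real) set" where
  "class_N = {\<gamma>. (\<forall>s\<ge>0. 0 \<le> \<gamma> s) \<and> continuous_on {0..} \<gamma> \<and> mono_on {0..} \<gamma> \<and> \<gamma> 0 = 0}"

definition class_K_inf :: "(real \<Rightarrow> real) set" where
  "class_K_inf = {\<gamma>. (\<forall>s\<ge>0. 0 \<le> \<gamma> s) \<and> continuous_on {0..} \<gamma> \<and> strict_mono_on {0..} \<gamma>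
     \<and> \<not> bounded (\<gamma> ` {0..}) \<and> \<gamma> 0 = 0}"

definition Linf_loc :: "'a::euclidean_space set \<Rightarrow> (real \<Rightarrow> 'a) set" where
  "Linf_loc D = {d. (\<forall>t\<ge>0. d t \<in> D) \<and> d \<in> borel_measurable (lebesgue_on {0..})
     \<and> (\<forall>K. compact K \<and> K \<subseteq> {0..} \<longrightarrow> (\<exists>M. AE t in lebesgue_on K. norm (d t) \<le> M))}"

definition abs_cont_on :: "real \<Rightarrow> real \<Rightarrow> (real \<Rightarrow> 'a::real_normed_vector) \<Rightarrow> bool" where
  "abs_cont_on a b x \<longleftrightarrow>
     (\<forall>\<epsilon>>0. \<exists>\<eta>>0. \<forall>(N::nat) (\<alpha> :: nat \<Rightarrow> real) \<beta>.
        (\<forall>i<N. a \<le> \<alpha> i \<and> \<alpha> i \<le> \<beta> i \<and> \<beta> i \<le> b)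
        \<and> disjoint_family_on (\<lambda>i. {\<alpha> i<..<\<beta> i}) {..<N}
        \<and> (\<Sum>i<N. \<beta> i - \<alpha> i) < \<eta>
        \<longrightarrow> (\<Sum>i<N. norm (x (\<beta> i) - x (\<alpha> i))) < \<epsilon>)"

text \<open>\<open>solves f d u x0 J x\<close>: on the interval \<open>J\<close> (starting at 0), \<open>x\<close> solves
  \<open>x' = f(d,x,u)\<close>, \<open>x(0) = x0\<close>. On an unbounded \<open>J\<close>, absolute continuity is
  required on every compact subinterval.\<close>

definition solves ::
  "('d \<Rightarrow> 'a::real_normed_vector \<Rightarrow> 'u \<Rightarrow> 'a) \<Rightarrow> (real \<Rightarrow> 'd) \<Rightarrow> (real \<Rightarrow> 'u) \<Rightarrow> 'a
    \<Rightarrow> real set \<Rightarrow> (real \<Rightarrow> 'a) \<Rightarrow> bool" where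
  "solves f d u x0 J x \<longleftrightarrow>
     x 0 = x0
     \<and> (\<forall>a b. {a..b} \<subseteq> J \<longrightarrow> abs_cont_on a b x)
     \<and> (AE t in lebesgue_on J. (x has_vector_derivative f (d t) (x t) (u t)) (at t within J))"

text \<open>``The solution exists on \<open>J\<close> and satisfies \<open>P\<close>''. Functions are total, so a solution on \<open>J\<close>
  is unique at best on \<open>J\<close>; hence \<open>P\<close> is demanded of every solution.\<close>

definition the_solution_satisfies ::
  "('d \<Rightarrow> 'a::real_normed_vector \<Rightarrow> 'u \<Rightarrow> 'a) \<Rightarrow> (real \<Rightarrow> 'd) \<Rightarrow> (real \<Rightarrow> 'u) \<Rightarrow> 'a
    \<Rightarrow> real set \<Rightarrow> ((real \<Rightarrow> 'a) \<Rightarrow> bool) \<Rightarrow> bool" where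
  "the_solution_satisfies f d u x0 J P \<longleftrightarrow>
     (\<exists>x. solves f d u x0 J x) \<and> (\<forall>x. solves f d u x0 J x \<longrightarrow> P x)"

definition H1 ::
  "('d::euclidean_space \<Rightarrow> 'a::euclidean_space \<Rightarrow> 'u::euclidean_space \<Rightarrow> 'a)
    \<Rightarrow> 'd set \<Rightarrow> 'u set \<Rightarrow> bool" where
  "H1 f D U \<longleftrightarrow>
     continuous_on (D \<times> UNIV \<times> U) (\<lambda>(d, x, u). f d x u)
     \<and> (\<forall>S \<subseteq> UNIV \<times> U. bounded S \<longrightarrow>
          (\<exists>L\<ge>0. \<forall>d\<in>D. \<forall>x y u. (x, u) \<in> S \<and> (y, u) \<in> S \<longrightarrow>
             (x - y) \<bullet> (f d x u - f d y u) \<le> L * (norm (x - y))\<^sup>2))"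

definition H2 ::
  "('d::euclidean_space \<Rightarrow> 'a::euclidean_space \<Rightarrow> 'u::euclidean_space \<Rightarrow> 'a)
    \<Rightarrow> 'd set \<Rightarrow> 'u set \<Rightarrow> bool" where
  "H2 f D U \<longleftrightarrow>
     (\<exists>a\<in>class_K_inf. \<forall>u\<in>U. \<forall>d\<in>D. \<forall>x. norm (f d x u) \<le> a (norm x + norm u))"

definition robustly_reachable_const ::
  "('d::euclidean_space \<Rightarrow> 'a::euclidean_space \<Rightarrow> 'u::euclidean_space \<Rightarrow> 'a)
    \<Rightarrow> 'd set \<Rightarrow> 'u set \<Rightarrow> real \<Rightarrow> 'a set \<Rightarrow> 'a set \<Rightarrow> bool" where
  "robustly_reachable_const f D U r A \<Omega> \<longleftrightarrow>
     (\<exists>v\<in>U. \<exists>c\<ge>0. \<exists>a\<in>class_N. \<exists>b\<in>class_N.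
        \<forall>x0\<in>\<Omega>. \<forall>d\<in>Linf_loc D. \<exists>T\<in>{0..c + b (norm x0)}.
          the_solution_satisfies f d (\<lambda>_. v) x0 {0..T + r}
            (\<lambda>x. (\<forall>t\<in>{0..T + r}. norm (x t) \<le> a (norm x0))
               \<and> (\<forall>t\<in>{T..T + r}. x t \<in> A)
               \<and> (\<forall>t\<in>{0..T}. x t \<in> \<Omega>)))"

end

theory Submission
  imports Defs
begin

text \<open>Along a solution \<open>V\<close> decreases at rate at least \<open>\<delta>\<close> as long as it is at least \<open>R\<close>, so
  it is at most \<open>R\<close> from the time \<open>T = max 0 ((V x0 - R) / \<delta>)\<close> on, and \<open>T\<close> does not depend
  on \<open>d\<close>. A continuous radial majorant of \<open>T\<close> gives \<open>c + b\<close>, and the growth bound at time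
  \<open>c + b + r\<close> gives \<open>a\<close>. A solution that is only given on \<open>{0..T + r}\<close> is the restriction of
  the global one by uniqueness.\<close>

text \<open>The differential equation holds only almost everywhere, so the classical mean value
  theorem does not apply to \<open>V\<close> along a solution. Absolute continuity is what excludes
  behaviour like that of the Cantor function, which increases although its derivative is zero almost
  everywhere. The decay of \<open>V\<close> and the uniqueness of solutions both rest on one
  inequality: an absolutely continuous real function whose derivative is at most \<open>c\<close>
  almost everywhere grows by at most \<open>c\<close> times the elapsed time. It is applied to
  \<open>V (x t)\<close> and to a weighted squared distance of two solutions. A second obstacle is
  that the decrease is known only where \<open>V\<close> is at least \<open>R\<close>: below that
  level \<open>V\<close> may rise again, and a return above \<open>R\<close> has to be
  excluded.\<close>

section \<open>Interval lengths and open covers of null sets\<close>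

lemma sum_length_le_measure:
  fixes \<alpha> \<beta> :: "'i \<Rightarrow> real"
  assumes "finite I" "disjoint_family_on (\<lambda>i. {\<alpha> i<..<\<beta> i}) I"
    and "\<And>i. i \<in> I \<Longrightarrow> \<alpha> i \<le> \<beta> i" "\<And>i. i \<in> I \<Longrightarrow> {\<alpha> i<..<\<beta> i} \<subseteq> G"
    and "G \<in> lmeasurable"
  shows "(\<Sum>i\<in>I. \<beta> i - \<alpha> i) \<le> measure lebesgue G"
proof -
  have "(\<Sum>i\<in>I. \<beta> i - \<alpha> i) = (\<Sum>i\<in>I. measure lebesgue {\<alpha> i<..<\<beta> i})"
    using assms(3) by (intro sum.cong) auto
  also have "\<dots> = measure lebesgue (\<Union>i\<in>I. {\<alpha> i<..<\<beta> i})"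
    using assms by (intro measure_finite_Union[symmetric]) (auto simp: emeasure_lborel_Ioo)
  also have "\<dots> \<le> measure lebesgue G"
    using assms by (intro measure_mono_fmeasurable) auto
  finally show ?thesis .
qed

lemma AE_lebesgue_on_outer_open:
  fixes a b \<eta> :: real
  assumes "AE t in lebesgue_on {a..b}. P t" "\<eta> > 0"
  obtains G where "open G" "G \<in> lmeasurable" "measure lebesgue G < \<eta>"
    "{t \<in> {a..b}. \<not> P t} \<subseteq> G"
proof -
  have "AE t in lebesgue. t \<in> {a..b} \<longrightarrow> P t"
    using assms(1) by (subst (asm) AE_restrict_space_iff) auto
  then obtain N where N: "{t \<in> {a..b}. \<not> P t} \<subseteq> N" "N \<in> null_sets lebesgue"
    unfolding eventually_ae_filter by auto
  then have "N \<in> sets lebesgue" by blast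
  then obtain G where G: "open G" "N \<subseteq> G" "G - N \<in> lmeasurable" "emeasure lebesgue (G - N) < ennreal \<eta>"
    using sets_lebesgue_outer_open assms(2) by blast
  \<comment> \<open>Outer regularity bounds only \<open>G - N\<close>; since \<open>N\<close> is a
    null set, the bound passes to \<open>G\<close> itself.\<close>
  have eq: "emeasure lebesgue (G - N) = emeasure lebesgue G"
    using N(2) G(1) by (intro emeasure_Diff_null_set) auto
  have "G \<in> lmeasurable"
    using G(1,4) eq by (intro fmeasurableI) (auto simp: less_top[symmetric] top_unique)
  moreover have "measure lebesgue G < \<eta>"
    using G(4) eq emeasure_eq_measure2[OF \<open>G \<in> lmeasurable\<close>] assms(2) by (simp add: ennreal_less_iff)
  ultimately show ?thesis using that G(1,2) N(1) by blast
qed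

section \<open>Absolutely continuous functions\<close>

text \<open>Two dominating functions cover differences and pairs; with both equal, the same estimate
  covers images under a Lipschitz map.\<close>

lemma abs_cont_on_dominated:
  assumes x: "abs_cont_on a b x" and y: "abs_cont_on a b y" and "C \<ge> 0"
    and g: "\<And>s t. s \<in> {a..b} \<Longrightarrow> t \<in> {a..b} \<Longrightarrow>
      norm (g t - g s) \<le> C * (norm (x t - x s) + norm (y t - y s))"
  shows "abs_cont_on a b g"
  unfolding abs_cont_on_def
proof (intro allI impI)
  fix e :: real assume "e > 0"
  \<comment> \<open>The 2 splits \<open>e\<close> between the two sums; \<open>C + 1\<close> instead
    of \<open>C\<close> admits \<open>C = 0\<close> and makes the final inequality strict.\<close>
  define e' where "e' = e / (2 * (C + 1))"
  have e': "e' > 0" using \<open>e > 0\<close> \<open>C \<ge> 0\<close> by (auto simp: e'_def)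
  obtain h1 where h1: "h1 > 0" "\<And>(N::nat) \<alpha> \<beta>. (\<forall>i<N. a \<le> \<alpha> i \<and> \<alpha> i \<le> \<beta> i \<and> \<beta> i \<le> b)
        \<and> disjoint_family_on (\<lambda>i. {\<alpha> i<..<\<beta> i}) {..<N}
        \<and> (\<Sum>i<N. \<beta> i - \<alpha> i) < h1
        \<Longrightarrow> (\<Sum>i<N. norm (x (\<beta> i) - x (\<alpha> i))) < e'"
    using x e' unfolding abs_cont_on_def by meson
  obtain h2 where h2: "h2 > 0" "\<And>(N::nat) \<alpha> \<beta>. (\<forall>i<N. a \<le> \<alpha> i \<and> \<alpha> i \<le> \<beta> i \<and> \<beta> i \<le> b)
        \<and> disjoint_family_on (\<lambda>i. {\<alpha> i<..<\<beta> i}) {..<N}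
        \<and> (\<Sum>i<N. \<beta> i - \<alpha> i) < h2
        \<Longrightarrow> (\<Sum>i<N. norm (y (\<beta> i) - y (\<alpha> i))) < e'"
    using y e' unfolding abs_cont_on_def by meson
  show "\<exists>\<eta>>0. \<forall>(N::nat) \<alpha> \<beta>. (\<forall>i<N. a \<le> \<alpha> i \<and> \<alpha> i \<le> \<beta> i \<and> \<beta> i \<le> b)
        \<and> disjoint_family_on (\<lambda>i. {\<alpha> i<..<\<beta> i}) {..<N}
        \<and> (\<Sum>i<N. \<beta> i - \<alpha> i) < \<eta>
        \<longrightarrow> (\<Sum>i<N. norm (g (\<beta> i) - g (\<alpha> i))) < e"
  proof (rule exI[of _ "min h1 h2"], intro conjI allI impI)
    show "min h1 h2 > 0" using h1 h2 by simp
    fix N :: nat and \<alpha> \<beta> :: "nat \<Rightarrow> real"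
    assume A: "(\<forall>i<N. a \<le> \<alpha> i \<and> \<alpha> i \<le> \<beta> i \<and> \<beta> i \<le> b)
        \<and> disjoint_family_on (\<lambda>i. {\<alpha> i<..<\<beta> i}) {..<N}
        \<and> (\<Sum>i<N. \<beta> i - \<alpha> i) < min h1 h2"
    have X: "(\<Sum>i<N. norm (x (\<beta> i) - x (\<alpha> i))) < e'"
      using A by (intro h1(2)) auto
    have Y: "(\<Sum>i<N. norm (y (\<beta> i) - y (\<alpha> i))) < e'"
      using A by (intro h2(2)) auto
    have "(\<Sum>i<N. norm (g (\<beta> i) - g (\<alpha> i))) \<le>
      (\<Sum>i<N. C * (norm (x (\<beta> i) - x (\<alpha> i)) + norm (y (\<beta> i) - y (\<alpha> i))))"
      using A by (intro sum_mono g) fastforce+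
    also have "\<dots> = C * ((\<Sum>i<N. norm (x (\<beta> i) - x (\<alpha> i))) + (\<Sum>i<N. norm (y (\<beta> i) - y (\<alpha> i))))"
      by (simp flip: sum_distrib_left sum.distrib)
    also have "\<dots> \<le> C * (2 * e')"
      using X Y \<open>C \<ge> 0\<close> by (intro mult_left_mono) auto
    also have "\<dots> < e"
      using \<open>e > 0\<close> \<open>C \<ge> 0\<close> by (simp add: e'_def field_simps)
    finally show "(\<Sum>i<N. norm (g (\<beta> i) - g (\<alpha> i))) < e" .
  qed
qed

lemma abs_cont_on_id: "abs_cont_on a b (\<lambda>t::real. t)"
  unfolding abs_cont_on_def
proof (intro allI impI)
  fix e :: real assume "e > 0"
  show "\<exists>\<eta>>0. \<forall>(N::nat) \<alpha> \<beta>. (\<forall>i<N. a \<le> \<alpha> i \<and> \<alpha> i \<le> \<beta> i \<and> \<beta> i \<le> b)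
        \<and> disjoint_family_on (\<lambda>i. {\<alpha> i<..<\<beta> i}) {..<N}
        \<and> (\<Sum>i<N. \<beta> i - \<alpha> i) < \<eta>
        \<longrightarrow> (\<Sum>i<N. norm (\<beta> i - \<alpha> i)) < e"
  proof (rule exI[of _ e], intro conjI allI impI)
    fix N :: nat and \<alpha> \<beta> :: "nat \<Rightarrow> real"
    assume A: "(\<forall>i<N. a \<le> \<alpha> i \<and> \<alpha> i \<le> \<beta> i \<and> \<beta> i \<le> b)
        \<and> disjoint_family_on (\<lambda>i. {\<alpha> i<..<\<beta> i}) {..<N}
        \<and> (\<Sum>i<N. \<beta> i - \<alpha> i) < e"
    then have "(\<Sum>i<N. norm (\<beta> i - \<alpha> i)) = (\<Sum>i<N. \<beta> i - \<alpha> i)"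
      by (intro sum.cong) auto
    with A show "(\<Sum>i<N. norm (\<beta> i - \<alpha> i)) < e" by simp
  qed fact
qed

lemma abs_cont_on_diff:
  assumes "abs_cont_on a b x" "abs_cont_on a b y"
  shows "abs_cont_on a b (\<lambda>t. x t - y t)"
proof (rule abs_cont_on_dominated[OF assms, of 1])
  fix s t
  show "norm (x t - y t - (x s - y s)) \<le> 1 * (norm (x t - x s) + norm (y t - y s))"
    using norm_triangle_ineq4[of "x t - x s" "y t - y s"] by (simp add: algebra_simps)
qed simp

lemma abs_cont_on_Pair:
  assumes "abs_cont_on a b x" "abs_cont_on a b y"
  shows "abs_cont_on a b (\<lambda>t. (x t, y t))"
proof (rule abs_cont_on_dominated[OF assms, of 1])
  fix s t
  show "norm ((x t, y t) - (x s, y s)) \<le> 1 * (norm (x t - x s) + norm (y t - y s))"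
    using norm_Pair_le by simp
qed simp

lemma abs_cont_on_imp_continuous_on:
  assumes "abs_cont_on a b x"
  shows "continuous_on {a..b} x"
  unfolding continuous_on_iff
proof (intro ballI allI impI)
  fix t e :: real assume t: "t \<in> {a..b}" and "e > 0"
  then obtain h where h: "h > 0" "\<And>(N::nat) \<alpha> \<beta>. (\<forall>i<N. a \<le> \<alpha> i \<and> \<alpha> i \<le> \<beta> i \<and> \<beta> i \<le> b)
        \<and> disjoint_family_on (\<lambda>i. {\<alpha> i<..<\<beta> i}) {..<N}
        \<and> (\<Sum>i<N. \<beta> i - \<alpha> i) < h
        \<Longrightarrow> (\<Sum>i<N. norm (x (\<beta> i) - x (\<alpha> i))) < e"
    using assms unfolding abs_cont_on_def by meson
  \<comment> \<open>Continuity is absolute continuity tested on a family of one interval.\<close>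
  have *: "norm (x v - x u) < e" if "a \<le> u" "u \<le> v" "v \<le> b" "v - u < h" for u v
    using h(2)[of 1 "\<lambda>_. u" "\<lambda>_. v"] that by (simp add: disjoint_family_on_def)
  show "\<exists>d>0. \<forall>t'\<in>{a..b}. dist t' t < d \<longrightarrow> dist (x t') (x t) < e"
  proof (rule exI[of _ h], intro conjI ballI impI h)
    fix t' assume t': "t' \<in> {a..b}" "dist t' t < h"
    show "dist (x t') (x t) < e"
    proof (cases "t \<le> t'")
      case True
      with *[of t t'] t t' show ?thesis by (auto simp: dist_norm)
    next
      case False
      with *[of t' t] t t' show ?thesis by (auto simp: dist_norm norm_minus_commute)
    qed
  qed
qed

text \<open>The definition numbers its intervals, whereas those of a tagged division are indexed by
  pairs of a tag and a set; a bijection with \<open>{..<card I}\<close> transfers the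
  estimate.\<close>

lemma abs_cont_on_sum_over_set:
  assumes "abs_cont_on a b x" "e > 0"
  obtains h where "h > 0"
    "\<And>(I :: 'i set) \<alpha> \<beta>. finite I \<Longrightarrow> (\<And>i. i \<in> I \<Longrightarrow> a \<le> \<alpha> i \<and> \<alpha> i \<le> \<beta> i \<and> \<beta> i \<le> b) \<Longrightarrow>
      disjoint_family_on (\<lambda>i. {\<alpha> i<..<\<beta> i}) I \<Longrightarrow> (\<Sum>i\<in>I. \<beta> i - \<alpha> i) < h \<Longrightarrow>
      (\<Sum>i\<in>I. norm (x (\<beta> i) - x (\<alpha> i))) < e"
proof -
  obtain h where h: "h > 0" "\<And>(N::nat) \<alpha> \<beta>. (\<forall>i<N. a \<le> \<alpha> i \<and> \<alpha> i \<le> \<beta> i \<and> \<beta> i \<le> b)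
        \<and> disjoint_family_on (\<lambda>i. {\<alpha> i<..<\<beta> i}) {..<N}
        \<and> (\<Sum>i<N. \<beta> i - \<alpha> i) < h
        \<Longrightarrow> (\<Sum>i<N. norm (x (\<beta> i) - x (\<alpha> i))) < e"
    using assms unfolding abs_cont_on_def by meson
  show ?thesis
  proof (rule that[OF h(1)])
    fix I :: "'i set" and \<alpha> \<beta> :: "'i \<Rightarrow> real"
    assume I: "finite I" "\<And>i. i \<in> I \<Longrightarrow> a \<le> \<alpha> i \<and> \<alpha> i \<le> \<beta> i \<and> \<beta> i \<le> b"
      "disjoint_family_on (\<lambda>i. {\<alpha> i<..<\<beta> i}) I" "(\<Sum>i\<in>I. \<beta> i - \<alpha> i) < h"
    obtain k where k: "bij_betw k {..<card I} I"
      using ex_bij_betw_nat_finite[OF I(1)] by (auto simp: atLeast0LessThan)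
    have kI: "k i \<in> I" if "i < card I" for i
      using k that by (auto simp: bij_betw_def)
    have "(\<Sum>i<card I. norm (x (\<beta> (k i)) - x (\<alpha> (k i)))) < e"
    proof (rule h(2), intro conjI allI impI)
      show "disjoint_family_on (\<lambda>i. {\<alpha> (k i)<..<\<beta> (k i)}) {..<card I}"
        unfolding disjoint_family_on_def
      proof (intro ballI impI)
        fix m n assume mn: "m \<in> {..<card I}" "n \<in> {..<card I}" "m \<noteq> n"
        then have "k m \<noteq> k n" using k by (auto simp: bij_betw_def inj_on_def)
        then show "{\<alpha> (k m)<..<\<beta> (k m)} \<inter> {\<alpha> (k n)<..<\<beta> (k n)} = {}"
          using I(3) kI mn unfolding disjoint_family_on_def by (metis lessThan_iff)
      qed
      show "(\<Sum>i<card I. \<beta> (k i) - \<alpha> (k i)) < h"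
        using I(4) sum.reindex_bij_betw[OF k, of "\<lambda>i. \<beta> i - \<alpha> i"] by simp
    qed (use I(2) kI in auto)
    then show "(\<Sum>i\<in>I. norm (x (\<beta> i) - x (\<alpha> i))) < e"
      using sum.reindex_bij_betw[OF k, of "\<lambda>i. norm (x (\<beta> i) - x (\<alpha> i))"] by simp
  qed
qed

section \<open>Mean value inequality under an almost everywhere derivative bound\<close>

text \<open>Since \<open>t\<close> lies between \<open>u\<close> and \<open>v\<close>, the
  first-order errors on its two sides add up to exactly \<open>e * (v - u)\<close>; for an interval
  away from \<open>t\<close> they would not be controlled by its length.\<close>

lemma has_vector_derivative_straddle_le:
  fixes g :: "real \<Rightarrow> real"
  assumes "(g has_vector_derivative q) (at t within S)" "q \<le> c" "e > 0"
  obtains r where "r > 0"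
    "\<And>u v. u \<in> S \<Longrightarrow> v \<in> S \<Longrightarrow> u \<le> t \<Longrightarrow> t \<le> v \<Longrightarrow> {u..v} \<subseteq> ball t r \<Longrightarrow>
      g v - g u \<le> (c + e) * (v - u)"
proof -
  obtain r where r: "r > 0"
    "\<And>y. y \<in> S \<Longrightarrow> norm (y - t) < r \<Longrightarrow> norm (g y - g t - (y - t) *\<^sub>R q) \<le> e * norm (y - t)"
    using assms unfolding has_vector_derivative_def has_derivative_within_alt by blast
  show ?thesis
  proof (rule that[OF r(1)])
    fix u v assume uv: "u \<in> S" "v \<in> S" "u \<le> t" "t \<le> v" "{u..v} \<subseteq> ball t r"
    then have "u \<in> ball t r" "v \<in> ball t r" by (meson atLeastAtMost_iff order.refl order.trans subsetD)+
    then have "norm (u - t) < r" "norm (v - t) < r" by (auto simp: dist_norm norm_minus_commute)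
    with r(2)[of u] r(2)[of v] uv
    have "g v - g t \<le> (v - t) * q + e * (v - t)" "g t - g u \<le> (t - u) * q + e * (t - u)"
      by (auto simp: algebra_simps abs_if split: if_splits)
    then have "g v - g u \<le> (q + e) * (v - u)" by (simp add: algebra_simps)
    also have "\<dots> \<le> (c + e) * (v - u)" using assms(2) uv by (intro mult_right_mono) auto
    finally show "g v - g u \<le> (c + e) * (v - u)" .
  qed
qed

text \<open>By Cousin's lemma: a gauge is chosen so that intervals tagged outside the exceptional null
  set obey the derivative bound, while those tagged inside it lie in an open set so small that
  absolute continuity controls their total contribution.\<close>

lemma abs_cont_on_deriv_le_imp_increment_le:
  fixes g :: "real \<Rightarrow> real"
  assumes "a \<le> b" and g: "abs_cont_on a b g"
    and ae: "AE t in lebesgue_on {a..b}. \<exists>q\<le>c. (g has_vector_derivative q) (at t within {a..b})"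
  shows "g b - g a \<le> c * (b - a)"
proof (rule field_le_epsilon)
  fix \<epsilon> :: real assume "\<epsilon> > 0"
  \<comment> \<open>The slope \<open>c + e\<close> costs an extra \<open>e * (b - a)\<close>; the
    exceptional intervals cost \<open>e\<close> for their increments and \<open>e\<close> for the
    linear term.\<close>
  define e where "e = \<epsilon> / (b - a + 2)"
  have e: "e > 0" and e_le: "2 * e + e * (b - a) = \<epsilon>"
  proof -
    have "e * (b - a + 2) = \<epsilon>" using \<open>a \<le> b\<close> by (simp add: e_def)
    then show "2 * e + e * (b - a) = \<epsilon>" by (simp add: algebra_simps)
    show "e > 0" using \<open>\<epsilon> > 0\<close> \<open>a \<le> b\<close> by (simp add: e_def)
  qed
  let ?good = "\<lambda>t. \<exists>q\<le>c. (g has_vector_derivative q) (at t within {a..b})"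
  obtain h where h: "h > 0"
    "\<And>(I :: (real \<times> real set) set) \<alpha> \<beta>. finite I \<Longrightarrow>
      (\<And>i. i \<in> I \<Longrightarrow> a \<le> \<alpha> i \<and> \<alpha> i \<le> \<beta> i \<and> \<beta> i \<le> b) \<Longrightarrow>
      disjoint_family_on (\<lambda>i. {\<alpha> i<..<\<beta> i}) I \<Longrightarrow> (\<Sum>i\<in>I. \<beta> i - \<alpha> i) < h \<Longrightarrow>
      (\<Sum>i\<in>I. norm (g (\<beta> i) - g (\<alpha> i))) < e"
    using abs_cont_on_sum_over_set[OF g e, where 'i = "real \<times> real set"] by blast
  \<comment> \<open>The second bound gives \<open>\<bar>c + e\<bar> * h' \<le> e\<close>, which
    makes the linear term over the exceptional intervals small as well.\<close>
  define h' where "h' = min h (e / (\<bar>c + e\<bar> + 1))"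
  have "h' > 0" using h(1) e by (auto simp: h'_def)
  obtain G where G: "open G" "G \<in> lmeasurable" "measure lebesgue G < h'"
    "{t \<in> {a..b}. \<not> ?good t} \<subseteq> G"
    using AE_lebesgue_on_outer_open[OF ae \<open>h' > 0\<close>] by blast
  have "\<exists>r>0. if ?good t then
      \<forall>u v. u \<in> {a..b} \<longrightarrow> v \<in> {a..b} \<longrightarrow> u \<le> t \<longrightarrow> t \<le> v \<longrightarrow> {u..v} \<subseteq> ball t r \<longrightarrow>
        g v - g u \<le> (c + e) * (v - u)
    else t \<in> {a..b} \<longrightarrow> ball t r \<subseteq> G" for t
  proof (cases "?good t")
    case True
    then obtain q where q: "q \<le> c" "(g has_vector_derivative q) (at t within {a..b})" by blast
    show ?thesis
      using has_vector_derivative_straddle_le[OF q(2,1) e] True by (auto split: if_splits) metis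
  next
    case False
    then have "t \<in> {a..b} \<Longrightarrow> t \<in> G" using G(4) by auto
    with G(1) show ?thesis
      unfolding if_not_P[OF False] open_contains_ball by (metis zero_less_one)
  qed
  then obtain r where r: "\<And>t. r t > 0"
    and good: "\<And>t u v. ?good t \<Longrightarrow> u \<in> {a..b} \<Longrightarrow> v \<in> {a..b} \<Longrightarrow> u \<le> t \<Longrightarrow> t \<le> v \<Longrightarrow>
      {u..v} \<subseteq> ball t (r t) \<Longrightarrow> g v - g u \<le> (c + e) * (v - u)"
    and bad: "\<And>t. \<not> ?good t \<Longrightarrow> t \<in> {a..b} \<Longrightarrow> ball t (r t) \<subseteq> G"
    by metis
  have "gauge (\<lambda>t. ball t (r t))" using r by (auto simp: gauge_def)
  then obtain p where p: "p tagged_division_of {a..b}" and fine: "(\<lambda>t. ball t (r t)) fine p"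
    using fine_division_exists_real by blast
  have finp: "finite p" using p by blast
  have piece: "a \<le> Inf K \<and> Inf K \<le> t \<and> t \<le> Sup K \<and> Sup K \<le> b \<and> K = {Inf K..Sup K}
      \<and> K \<subseteq> ball t (r t)" if tK: "(t, K) \<in> p" for t K
  proof -
    have K: "t \<in> K" "K \<subseteq> {a..b}" using tagged_division_ofD[OF p] tK by blast+
    obtain u v where uv: "K = cbox u v" using tagged_division_ofD(4)[OF p tK] by blast
    have "u \<le> v" using K uv by auto
    then have "Inf K = u" "Sup K = v" using uv by auto
    moreover have "u \<in> K" "v \<in> K" using \<open>u \<le> v\<close> uv by auto
    moreover have "K \<subseteq> ball t (r t)" using fine tK by (auto simp: fine_def)
    ultimately show ?thesis using K uv by (auto simp: subset_iff)
  qed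
  \<comment> \<open>\<open>\<psi>\<close> is the excess of an increment over the slope
    \<open>c + e\<close>. By telescoping, its sum over \<open>p\<close> is the excess on
    \<open>{a..b}\<close>, and only the pieces in \<open>B\<close>, those with exceptional tags, can
    contribute positively.\<close>
  define \<psi> where "\<psi> = (\<lambda>(t::real, K). g (Sup K) - g (Inf K) - (c + e) * (Sup K - Inf K))"
  define B where "B = {tK \<in> p. \<not> ?good (fst tK)}"
  have B: "B \<subseteq> p" "finite B" using finp by (auto simp: B_def)
  have disj: "disjoint_family_on (\<lambda>i. {Inf (snd i)<..<Sup (snd i)}) B"
    unfolding disjoint_family_on_def
  proof (intro ballI impI)
    fix m n assume mn: "m \<in> B" "n \<in> B" "m \<noteq> n"
    have "interior (snd m) \<inter> interior (snd n) = {}"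
      using tagged_division_ofD(5)[OF p, of "fst m" "snd m" "fst n" "snd n"] mn B by auto
    moreover have "interior (snd i) = {Inf (snd i)<..<Sup (snd i)}" if "i \<in> B" for i
      using piece[of "fst i" "snd i"] that B interior_atLeastAtMost_real by (metis prod.collapse subsetD)
    ultimately show "{Inf (snd m)<..<Sup (snd m)} \<inter> {Inf (snd n)<..<Sup (snd n)} = {}"
      using mn by auto
  qed
  have len: "(\<Sum>i\<in>B. Sup (snd i) - Inf (snd i)) < h'"
  proof -
    have "(\<Sum>i\<in>B. Sup (snd i) - Inf (snd i)) \<le> measure lebesgue G"
    proof (rule sum_length_le_measure[OF B(2) disj _ _ G(2)])
      fix i assume i: "i \<in> B"
      then have i': "(fst i, snd i) \<in> p" "\<not> ?good (fst i)" using B by (auto simp: B_def)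
      note pc = piece[OF i'(1)]
      show "Inf (snd i) \<le> Sup (snd i)" using pc by linarith
      have "fst i \<in> {a..b}" using pc by auto
      then have "snd i \<subseteq> G" using bad[OF i'(2)] pc by blast
      moreover have "{Inf (snd i)<..<Sup (snd i)} \<subseteq> {Inf (snd i)..Sup (snd i)}" by auto
      ultimately show "{Inf (snd i)<..<Sup (snd i)} \<subseteq> G" using pc by auto
    qed
    with G(3) show ?thesis by linarith
  qed
  have inc: "(\<Sum>i\<in>B. norm (g (Sup (snd i)) - g (Inf (snd i)))) < e"
  proof (rule h(2)[OF B(2) _ disj])
    fix i assume "i \<in> B"
    then have "(fst i, snd i) \<in> p" using B by auto
    from piece[OF this] show "a \<le> Inf (snd i) \<and> Inf (snd i) \<le> Sup (snd i) \<and> Sup (snd i) \<le> b"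
      by linarith
  qed (use len in \<open>auto simp: h'_def\<close>)
  have "g b - g a - (c + e) * (b - a) = sum \<psi> p"
  proof -
    have "sum \<psi> p = (\<Sum>(t, K)\<in>p. g (Sup K) - g (Inf K)) - (c + e) * (\<Sum>(t, K)\<in>p. Sup K - Inf K)"
      unfolding \<psi>_def case_prod_unfold sum_distrib_left sum_subtractf[symmetric] ..
    then show ?thesis
      using additive_tagged_division_1[OF \<open>a \<le> b\<close> p, of g]
        additive_tagged_division_1[OF \<open>a \<le> b\<close> p, of "\<lambda>t. t"] by simp
  qed
  also have "sum \<psi> p = sum \<psi> (p - B) + sum \<psi> B"
    using B finp by (metis sum.subset_diff)
  also have "sum \<psi> (p - B) \<le> 0"
  proof (rule sum_nonpos)
    fix i assume i: "i \<in> p - B"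
    obtain t K where tK: "i = (t, K)" by force
    with i have "?good t" "(t, K) \<in> p" by (auto simp: B_def)
    with good[of t "Inf K" "Sup K"] piece[of t K] show "\<psi> i \<le> 0"
      by (auto simp: \<psi>_def tK)
  qed
  also have "sum \<psi> B \<le> (\<Sum>i\<in>B. norm (g (Sup (snd i)) - g (Inf (snd i))) + \<bar>c + e\<bar> * (Sup (snd i) - Inf (snd i)))"
  proof (rule sum_mono)
    fix i assume "i \<in> B"
    then have "(fst i, snd i) \<in> p" using B by auto
    then have "Inf (snd i) \<le> Sup (snd i)" using piece[of "fst i" "snd i"] by linarith
    then have "- ((c + e) * (Sup (snd i) - Inf (snd i))) \<le> \<bar>c + e\<bar> * (Sup (snd i) - Inf (snd i))"
      by (metis abs_ge_minus_self diff_ge_0_iff_ge minus_mult_left mult_right_mono)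
    then show "\<psi> i \<le> norm (g (Sup (snd i)) - g (Inf (snd i))) + \<bar>c + e\<bar> * (Sup (snd i) - Inf (snd i))"
      by (simp add: \<psi>_def case_prod_unfold)
  qed
  also have "\<dots> = (\<Sum>i\<in>B. norm (g (Sup (snd i)) - g (Inf (snd i)))) + \<bar>c + e\<bar> * (\<Sum>i\<in>B. Sup (snd i) - Inf (snd i))"
    by (simp add: sum.distrib sum_distrib_left)
  also have "\<dots> \<le> e + \<bar>c + e\<bar> * h'"
    using inc len by (intro add_mono mult_left_mono) auto
  also have "\<bar>c + e\<bar> * h' \<le> \<bar>c + e\<bar> * (e / (\<bar>c + e\<bar> + 1))"
    unfolding h'_def by (intro mult_left_mono) auto
  also have "\<dots> \<le> e" using e by (simp add: field_simps)
  finally show "g b - g a \<le> c * (b - a) + \<epsilon>" using e_le by (simp add: algebra_simps)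
qed

section \<open>Continuously differentiable functions along absolutely continuous curves\<close>

text \<open>A ball around \<open>S\<close> supplies compactness, hence a bound for \<open>G\<close>,
  and also the convexity that the mean value estimate requires and \<open>S\<close> may
  lack.\<close>

lemma GDERIV_lipschitz_on_bounded:
  fixes F :: "'a::euclidean_space \<Rightarrow> real"
  assumes F: "\<And>x. GDERIV F x :> G x" and G: "continuous_on UNIV G" and "bounded S"
  obtains C where "C \<ge> 0" "\<And>x y. x \<in> S \<Longrightarrow> y \<in> S \<Longrightarrow> norm (F x - F y) \<le> C * norm (x - y)"
proof -
  obtain \<rho> where \<rho>: "S \<subseteq> cball 0 \<rho>" using bounded_subset_ballD[OF \<open>bounded S\<close>] ball_subset_cball by (meson order_trans)
  have "compact (G ` cball 0 \<rho>)"
    using G by (intro compact_continuous_image) (auto intro: continuous_on_subset)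
  then obtain C where C: "C > 0" "\<And>x. x \<in> cball 0 \<rho> \<Longrightarrow> norm (G x) \<le> C"
    using compact_imp_bounded[of "G ` cball 0 \<rho>"] unfolding bounded_pos by blast
  show ?thesis
  proof (rule that[of C])
    fix x y assume "x \<in> S" "y \<in> S"
    show "norm (F x - F y) \<le> C * norm (x - y)"
    proof (rule differentiable_bound[OF convex_cball, of 0 \<rho> F "\<lambda>x h. h \<bullet> G x"])
      fix z :: 'a assume z: "z \<in> cball 0 \<rho>"
      show "(F has_derivative (\<lambda>h. h \<bullet> G z)) (at z within cball 0 \<rho>)"
        using F unfolding gderiv_def by (rule has_derivative_at_withinI)
      show "onorm (\<lambda>h. h \<bullet> G z) \<le> C"
      proof (rule onorm_le)
        fix h
        have "norm (h \<bullet> G z) \<le> norm h * norm (G z)" using Cauchy_Schwarz_ineq2 by auto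
        also have "\<dots> \<le> norm h * C" using C(2)[OF z] by (intro mult_left_mono) auto
        finally show "norm (h \<bullet> G z) \<le> C * norm h" by (simp add: mult.commute)
      qed
    qed (use \<rho> \<open>x \<in> S\<close> \<open>y \<in> S\<close> in auto)
  qed (use C in auto)
qed

text \<open>The image of \<open>w\<close> is compact, so \<open>F\<close> is Lipschitz on it and
  \<open>F (w t)\<close> inherits absolute continuity; the chain rule at the points where
  \<open>w\<close> is differentiable supplies the derivative bound.\<close>

lemma increment_le_of_gradient_bound:
  fixes F :: "'a::euclidean_space \<Rightarrow> real"
  assumes "a \<le> b" and w: "abs_cont_on a b w"
    and F: "\<And>x. GDERIV F x :> G x" and G: "continuous_on UNIV G"
    and ae: "AE t in lebesgue_on {a..b}.
      \<exists>q. (w has_vector_derivative q) (at t within {a..b}) \<and> q \<bullet> G (w t) \<le> c"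
  shows "F (w b) - F (w a) \<le> c * (b - a)"
proof (rule abs_cont_on_deriv_le_imp_increment_le[of a b "\<lambda>t. F (w t)"])
  have "bounded (w ` {a..b})"
    using abs_cont_on_imp_continuous_on[OF w]
    by (intro compact_imp_bounded compact_continuous_image) auto
  then obtain C where C: "C \<ge> 0"
    "\<And>x y. x \<in> w ` {a..b} \<Longrightarrow> y \<in> w ` {a..b} \<Longrightarrow> norm (F x - F y) \<le> C * norm (x - y)"
    using GDERIV_lipschitz_on_bounded[OF F G] by blast
  show "abs_cont_on a b (\<lambda>t. F (w t))"
  proof (rule abs_cont_on_dominated[OF w w C(1)])
    fix s t assume "s \<in> {a..b}" "t \<in> {a..b}"
    then have "norm (F (w t) - F (w s)) \<le> C * norm (w t - w s)" by (intro C(2)) auto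
    also have "\<dots> \<le> C * (norm (w t - w s) + norm (w t - w s))"
      using C(1) by (intro mult_left_mono) auto
    finally show "norm (F (w t) - F (w s)) \<le> C * (norm (w t - w s) + norm (w t - w s))" .
  qed
  show "AE t in lebesgue_on {a..b}.
    \<exists>q\<le>c. ((\<lambda>t. F (w t)) has_vector_derivative q) (at t within {a..b})"
    using ae
  proof eventually_elim
    case (elim t)
    then obtain q where q: "(w has_vector_derivative q) (at t within {a..b})" "q \<bullet> G (w t) \<le> c"
      by blast
    have "(F has_derivative (\<lambda>h. h \<bullet> G (w t))) (at (w t) within w ` {a..b})"
      using F unfolding gderiv_def by (rule has_derivative_at_withinI)
    from vector_derivative_diff_chain_within[OF q(1) this]
    have "((\<lambda>t. F (w t)) has_vector_derivative q \<bullet> G (w t)) (at t within {a..b})"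
      by (simp add: o_def)
    with q(2) show ?case by blast
  qed
qed fact

section \<open>Restriction and uniqueness of solutions\<close>

text \<open>Almost everywhere statements on \<open>J\<close> and \<open>K\<close> are compared
  through the whole line, and a derivative within \<open>J\<close> is also one within the smaller
  \<open>K\<close>.\<close>

lemma solves_subset:
  assumes x: "solves f d u x0 J x" and "K \<subseteq> J" and J: "J \<in> sets lebesgue" and K: "K \<in> sets lebesgue"
  shows "solves f d u x0 K x"
proof -
  have "AE t in lebesgue. t \<in> J \<longrightarrow> (x has_vector_derivative f (d t) (x t) (u t)) (at t within J)"
    using x J by (simp add: solves_def AE_restrict_space_iff)
  then have "AE t in lebesgue. t \<in> K \<longrightarrow> (x has_vector_derivative f (d t) (x t) (u t)) (at t within K)"
    by eventually_elim (use \<open>K \<subseteq> J\<close> in \<open>auto intro: has_vector_derivative_within_subset\<close>)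
  with x \<open>K \<subseteq> J\<close> K show ?thesis
    by (auto simp: solves_def AE_restrict_space_iff)
qed

lemma solves_on_subinterval:
  assumes x: "solves f d u x0 J x" and "{a..b} \<subseteq> J" and J: "J \<in> sets lebesgue"
  shows "abs_cont_on a b x"
    and "AE t in lebesgue_on {a..b}. (x has_vector_derivative f (d t) (x t) (u t)) (at t within {a..b})"
  using solves_subset[OF assms] assms by (auto simp: solves_def)

text \<open>Gronwall: the one-sided Lipschitz condition makes
  \<open>exp (-2 L t) |x(t) - y(t)|\<^sup>2\<close> nonincreasing.\<close>

lemma solves_unique:
  fixes f :: "'d::euclidean_space \<Rightarrow> 'a::euclidean_space \<Rightarrow> 'u::euclidean_space \<Rightarrow> 'a"
  assumes H1: "H1 f D U" and "v \<in> U" and d: "\<And>t. t \<in> {0..b} \<Longrightarrow> d t \<in> D"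
    and x: "solves f d (\<lambda>_. v) x0 {0..b} x" and y: "solves f d (\<lambda>_. v) x0 {0..b} y"
    and "t \<in> {0..b}"
  shows "x t = y t"
proof -
  have sub: "{0..t} \<subseteq> {0..b}" using \<open>t \<in> {0..b}\<close> by auto
  note X = solves_on_subinterval[OF x sub, simplified] and Y = solves_on_subinterval[OF y sub, simplified]
  \<comment> \<open>(H1) gives a constant only on bounded sets; compactness of the values of both
    solutions on \<open>{0..t}\<close> provides one set that serves the whole comparison.\<close>
  have "bounded (x ` {0..t} \<union> y ` {0..t})"
    using X(1) Y(1) by (auto simp del: bounded_Un intro!: compact_imp_bounded compact_Un
      compact_continuous_image abs_cont_on_imp_continuous_on)
  then have "bounded ((x ` {0..t} \<union> y ` {0..t}) \<times> {v})" by (intro bounded_Times) auto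
  moreover have "(x ` {0..t} \<union> y ` {0..t}) \<times> {v} \<subseteq> UNIV \<times> U" using \<open>v \<in> U\<close> by auto
  ultimately obtain L where L: "L \<ge> 0" "\<And>d p q. d \<in> D \<Longrightarrow> p \<in> x ` {0..t} \<union> y ` {0..t} \<Longrightarrow>
      q \<in> x ` {0..t} \<union> y ` {0..t} \<Longrightarrow> (p - q) \<bullet> (f d p v - f d q v) \<le> L * (norm (p - q))\<^sup>2"
    using H1 unfolding H1_def by (smt (verit) SigmaI singletonI)
  \<comment> \<open>Time becomes a coordinate, so the time-dependent weight is part of a
    continuously differentiable function and the increment bound applies to the curve
    \<open>(s, x s - y s)\<close>; \<open>G\<close> is the gradient of \<open>F\<close>.\<close>
  define F where "F = (\<lambda>z::real \<times> 'a. exp (- 2 * L * fst z) * (snd z \<bullet> snd z))"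
  define G where "G = (\<lambda>z::real \<times> 'a. (- 2 * L * exp (- 2 * L * fst z) * (snd z \<bullet> snd z),
    (2 * exp (- 2 * L * fst z)) *\<^sub>R snd z))"
  have "F (t, x t - y t) - F (0, x 0 - y 0) \<le> 0 * (t - 0)"
  proof (rule increment_le_of_gradient_bound[of 0 t "\<lambda>s. (s, x s - y s)" F G])
    show "abs_cont_on 0 t (\<lambda>s. (s, x s - y s))"
      using X Y by (intro abs_cont_on_Pair abs_cont_on_id abs_cont_on_diff) auto
    show "GDERIV F z :> G z" for z
      unfolding gderiv_def F_def G_def
      by (auto intro!: derivative_eq_intros simp: inner_prod_def algebra_simps inner_commute fun_eq_iff)
    show "continuous_on UNIV G" unfolding G_def by (intro continuous_intros)
    show "AE s in lebesgue_on {0..t}. \<exists>q.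
      ((\<lambda>s. (s, x s - y s)) has_vector_derivative q) (at s within {0..t}) \<and> q \<bullet> G (s, x s - y s) \<le> 0"
      using X(2) Y(2) AE_space
    proof eventually_elim
      case (elim s)
      then have s: "s \<in> {0..t}" by simp
      let ?q = "f (d s) (x s) v - f (d s) (y s) v"
      have "((\<lambda>s. (s, x s - y s)) has_vector_derivative (1, ?q)) (at s within {0..t})"
        using elim by (intro has_vector_derivative_Pair has_vector_derivative_diff) (auto intro: has_vector_derivative_id)
      moreover have "(x s - y s) \<bullet> ?q \<le> L * (norm (x s - y s))\<^sup>2"
        using s sub d by (intro L(2)) auto
      \<comment> \<open>Up to the exponential factor, the time component contributes
        \<open>-2 L |x - y|^2\<close>, which absorbs twice the one-sided Lipschitz bound.\<close>
      then have "(1, ?q) \<bullet> G (s, x s - y s) \<le> 0"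
        by (simp add: G_def inner_commute power2_norm_eq_inner)
      ultimately show ?case by blast
    qed
  qed (use \<open>t \<in> {0..b}\<close> in auto)
  moreover have "x 0 = y 0" using x y by (simp add: solves_def)
  ultimately have "exp (- 2 * L * t) * ((x t - y t) \<bullet> (x t - y t)) \<le> 0" by (simp add: F_def)
  then have "(x t - y t) \<bullet> (x t - y t) \<le> 0" by (simp add: mult_le_0_iff)
  then show ?thesis by (metis inner_gt_zero_iff not_less right_minus_eq)
qed

section \<open>Functions that decrease above a level\<close>

text \<open>\<open>dec\<close> concerns only intervals that end at \<open>t\<close> and on which
  \<open>\<phi>\<close> stays at least \<open>R\<close>. If \<open>\<phi> t > R\<close>, it is used
  from the last time at which \<open>\<phi>\<close> was at most \<open>R\<close>, or from 0 if there
  is no such time; in the latter case time \<open>T\<close> is enough to lose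
  \<open>\<phi> 0 - R\<close>.\<close>

lemma decreasing_above_level_trapped:
  fixes \<phi> :: "real \<Rightarrow> real"
  assumes cont: "continuous_on {0..t} \<phi>" and "\<delta> > 0"
    and dec: "\<And>s. 0 \<le> s \<Longrightarrow> s \<le> t \<Longrightarrow> (\<And>\<tau>. \<tau> \<in> {s..t} \<Longrightarrow> R \<le> \<phi> \<tau>) \<Longrightarrow> \<phi> t - \<phi> s \<le> - \<delta> * (t - s)"
    and "0 \<le> T" "T \<le> t" "\<phi> 0 - R \<le> \<delta> * T"
  shows "\<phi> t \<le> R"
proof (rule ccontr)
  assume "\<not> \<phi> t \<le> R"
  define S where "S = {\<tau> \<in> {0..t}. \<phi> \<tau> \<le> R}"
  show False
  proof (cases "S = {}")
    case True
    then have "\<phi> t - \<phi> 0 \<le> - \<delta> * (t - 0)"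
      using assms by (intro dec) (force simp: S_def)+
    moreover have "\<delta> * T \<le> \<delta> * t" using assms by (intro mult_left_mono) auto
    ultimately show False using assms \<open>\<not> \<phi> t \<le> R\<close> by (simp add: algebra_simps)
  next
    case False
    have "closed S" unfolding S_def
      using cont by (intro continuous_on_closed_Collect_le) auto
    then have "compact S"
      using bounded_subset[of "{0..t}" S] by (force simp: compact_eq_bounded_closed S_def)
    then obtain s where s: "s \<in> S" "\<And>\<tau>. \<tau> \<in> S \<Longrightarrow> \<tau> \<le> s"
      using compact_attains_sup[OF _ False] by blast
    have "continuous_on {s..t} \<phi>" using cont s by (auto simp: S_def elim!: continuous_on_subset)
    \<comment> \<open>If \<open>\<phi> s < R\<close>, the level would be crossed after
      \<open>s\<close>, contradicting the choice of \<open>s\<close> as the last element of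
      \<open>S\<close>. Equality at \<open>s\<close> makes \<open>dec\<close> applicable from
      \<open>s\<close> on.\<close>
    then obtain \<sigma> where \<sigma>: "s \<le> \<sigma>" "\<sigma> \<le> t" "\<phi> \<sigma> = R"
      using IVT'[of \<phi> s R t] s \<open>\<not> \<phi> t \<le> R\<close> by (auto simp: S_def)
    then have "\<sigma> \<in> S" using s by (auto simp: S_def)
    then have "\<phi> s = R" using s(2) \<sigma> by force
    have "R \<le> \<phi> \<tau>" if "\<tau> \<in> {s..t}" for \<tau>
      using s(2)[of \<tau>] that s(1) \<open>\<phi> s = R\<close> unfolding S_def by fastforce
    then have "\<phi> t - \<phi> s \<le> - \<delta> * (t - s)" using s by (intro dec) (auto simp: S_def)
    also have "\<dots> \<le> 0" using s \<open>\<delta> > 0\<close> by (auto simp: S_def intro: mult_nonneg_nonneg)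
    finally show False using \<open>\<phi> s = R\<close> \<open>\<not> \<phi> t \<le> R\<close> by simp
  qed
qed

section \<open>Comparison functions: radial majorants and inverses\<close>

lemma continuous_radial_majorant:
  fixes h :: "'a::euclidean_space \<Rightarrow> real"
  assumes h: "continuous_on UNIV h"
  obtains M where "continuous_on {0..} M" "mono_on {0..} M" "\<And>x. h x \<le> M (norm x)" "M 0 = h 0"
proof
  \<comment> \<open>For \<open>s \<ge> 0\<close> this is the maximum of \<open>h\<close> over the
    ball of radius \<open>s\<close>, written over the fixed unit ball: the index set does not move
    with \<open>s\<close>, so uniform continuity of \<open>h\<close> on bounded sets makes
    \<open>M\<close> continuous.\<close>
  define M where "M = (\<lambda>s. SUP y\<in>cball (0::'a) 1. h (s *\<^sub>R y))"
  have bdd: "bdd_above ((\<lambda>y. h (s *\<^sub>R y)) ` cball 0 1)" for s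
    using h by (intro bounded_imp_bdd_above compact_imp_bounded compact_continuous_image
      continuous_on_compose2[OF h] continuous_intros) auto
  have upper: "h (s *\<^sub>R y) \<le> M s" if "norm y \<le> 1" for s y
    unfolding M_def using that bdd by (intro cSUP_upper) auto
  have least: "M s \<le> K" if "\<And>y. norm y \<le> 1 \<Longrightarrow> h (s *\<^sub>R y) \<le> K" for s K
    unfolding M_def using that by (intro cSUP_least) auto
  show "M 0 = h 0"
    using upper[of 0 0] least[of 0 "h 0"] by simp
  show "h x \<le> M (norm x)" for x
    using upper[of "x /\<^sub>R norm x" "norm x"] upper[of 0 0] by (cases "x = 0") auto
  show "mono_on {0..} M"
  proof (rule mono_onI)
    fix s s' :: real assume s: "s \<in> {0..}" "s' \<in> {0..}" "s \<le> s'"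
    show "M s \<le> M s'"
    proof (rule least)
      fix y :: 'a assume y: "norm y \<le> 1"
      \<comment> \<open>If \<open>s' = 0\<close>, then \<open>s = 0\<close> as well; the quotient
        has the default value 0 and still represents the same point.\<close>
      have "norm ((s / s') *\<^sub>R y) \<le> 1"
        using s y mult_mono[of s s' "norm y" 1] by (cases "s' = 0") (auto simp: divide_le_eq_1)
      from upper[OF this, of s'] show "h (s *\<^sub>R y) \<le> M s'"
        using s by (cases "s' = 0") auto
    qed
  qed
  show "continuous_on {0..} M"
    unfolding continuous_on_iff
  proof (intro ballI allI impI)
    fix s e :: real assume s: "s \<in> {0..}" and "e > 0"
    have "uniformly_continuous_on (cball (0::'a) (s + 1)) h"
      using h by (intro compact_uniformly_continuous) (auto elim: continuous_on_subset)
    then obtain \<eta> where \<eta>: "\<eta> > 0" "\<And>p q. p \<in> cball 0 (s + 1) \<Longrightarrow> q \<in> cball 0 (s + 1) \<Longrightarrow>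
        dist q p < \<eta> \<Longrightarrow> dist (h q) (h p) < e / 2"
      using \<open>e > 0\<close> unfolding uniformly_continuous_on_def by (metis half_gt_zero)
    have close: "h (s1 *\<^sub>R y) \<le> h (s2 *\<^sub>R y) + e / 2"
      if "0 \<le> s1" "0 \<le> s2" "s1 \<le> s + 1" "s2 \<le> s + 1" "\<bar>s1 - s2\<bar> < \<eta>" "norm y \<le> 1" for s1 s2 and y :: 'a
    proof -
      have "s1 * norm y \<le> (s + 1) * 1" "s2 * norm y \<le> (s + 1) * 1"
        using that s by (intro mult_mono; auto)+
      moreover have "dist (s1 *\<^sub>R y) (s2 *\<^sub>R y) < \<eta>"
      proof -
        have "dist (s1 *\<^sub>R y) (s2 *\<^sub>R y) = \<bar>s1 - s2\<bar> * norm y"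
          by (metis dist_norm norm_scaleR scaleR_left_diff_distrib)
        also have "\<dots> \<le> \<bar>s1 - s2\<bar> * 1" using that by (intro mult_left_mono) auto
        finally show ?thesis using that by simp
      qed
      ultimately have "dist (h (s1 *\<^sub>R y)) (h (s2 *\<^sub>R y)) < e / 2"
        using that by (intro \<eta>(2)) auto
      then show ?thesis unfolding dist_real_def by linarith
    qed
    have M_le: "M s1 \<le> M s2 + e / 2"
      if "0 \<le> s1" "0 \<le> s2" "s1 \<le> s + 1" "s2 \<le> s + 1" "\<bar>s1 - s2\<bar> < \<eta>" for s1 s2
    proof (rule least)
      fix y :: 'a assume "norm y \<le> 1"
      with close[OF that] upper[of y s2] show "h (s1 *\<^sub>R y) \<le> M s2 + e / 2" by fastforce
    qed
    show "\<exists>d>0. \<forall>s'\<in>{0..}. dist s' s < d \<longrightarrow> dist (M s') (M s) < e"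
    proof (rule exI[of _ "min 1 \<eta>"], intro conjI ballI impI)
      fix s' assume "s' \<in> {0..}" "dist s' s < min 1 \<eta>"
      then have "M s \<le> M s' + e / 2" "M s' \<le> M s + e / 2"
        using s by (auto intro!: M_le simp: dist_real_def)
      with \<open>e > 0\<close> show "dist (M s') (M s) < e" by (auto simp: dist_real_def)
    qed (use \<eta> in auto)
  qed
qed

text \<open>Unboundedness and the intermediate value theorem make \<open>\<gamma>\<close> surjective
  onto \<open>{0..}\<close>, so its inverse is defined on the whole half-line. For \<open>a1\<close>
  this inverse turns a bound on \<open>a1 (norm (x t))\<close> into one on
  \<open>norm (x t)\<close>.\<close>

lemma class_K_inf_inverse:
  assumes "\<gamma> \<in> class_K_inf"
  obtains g where "continuous_on {0..} g" "mono_on {0..} g" "g 0 = 0"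
    "\<And>s. s \<ge> 0 \<Longrightarrow> g s \<ge> 0" "\<And>s. s \<ge> 0 \<Longrightarrow> g (\<gamma> s) = s"
proof -
  have \<gamma>: "\<And>s. s \<ge> 0 \<Longrightarrow> 0 \<le> \<gamma> s" "continuous_on {0..} \<gamma>" "strict_mono_on {0..} \<gamma>"
    "\<not> bounded (\<gamma> ` {0..})" "\<gamma> 0 = 0"
    using assms by (auto simp: class_K_inf_def)
  have image: "\<gamma> ` {0..} = {0..}"
  proof
    show "{0..} \<subseteq> \<gamma> ` {0..}"
    proof
      fix z :: real assume "z \<in> {0..}"
      obtain s where s: "s \<ge> 0" "\<gamma> s > z"
        using \<gamma>(1,4) unfolding bounded_iff by (metis abs_of_nonneg atLeast_iff imageE linorder_not_le real_norm_def)
      have "continuous_on {0..s} \<gamma>" using \<gamma>(2) by (rule continuous_on_subset) auto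
      then obtain x where "0 \<le> x" "x \<le> s" "\<gamma> x = z"
        using IVT'[of \<gamma> 0 z s] s \<gamma>(5) \<open>z \<in> {0..}\<close> by auto
      then show "z \<in> \<gamma> ` {0..}" by auto
    qed
  qed (use \<gamma>(1) in auto)
  obtain g where g: "homeomorphism {0..} {0..} \<gamma> g"
    using homeomorphism_into_1d[OF _ \<gamma>(2) image strict_mono_on_imp_inj_on[OF \<gamma>(3)]]
    by (auto intro: convex_imp_path_connected)
  show ?thesis
  proof (rule that[of g])
    show "continuous_on {0..} g" using g by (simp add: homeomorphism_def)
    show inv: "g (\<gamma> s) = s" if "s \<ge> 0" for s using g that by (auto simp: homeomorphism_def)
    show "g 0 = 0" using inv[of 0] \<gamma>(5) by simp
    show nonneg: "g s \<ge> 0" if "s \<ge> 0" for s using g that by (auto simp: homeomorphism_def)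
    show "mono_on {0..} g"
    proof (rule mono_onI)
      fix s t :: real assume st: "s \<in> {0..}" "t \<in> {0..}" "s \<le> t"
      have "\<gamma> (g s) = s" "\<gamma> (g t) = t" using g st by (auto simp: homeomorphism_def)
      then show "g s \<le> g t"
        using strict_mono_onD[OF \<gamma>(3), of "g t" "g s"] nonneg st by force
    qed
  qed
qed

section \<open>Uniform waiting time and norm bound for the controlled system\<close>

theorem lemma2p7:
  fixes f :: "real ^ 'l \<Rightarrow> real ^ 'n \<Rightarrow> real ^ 'm \<Rightarrow> real ^ 'n"
    and D :: "(real ^ 'l) set" and U :: "(real ^ 'm) set"
    and \<Omega> :: "(real ^ 'n) set"
    and V :: "real ^ 'n \<Rightarrow> real" and gradV :: "real ^ 'n \<Rightarrow> real ^ 'n"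
    and v :: "real ^ 'm" and R \<delta> p r :: real
    and a1 a2 :: "real \<Rightarrow> real"
  assumes "D \<noteq> {}" and "H1 f D U" and "H2 f D U"
    and V_C1: "\<And>x. GDERIV V x :> gradV x" "continuous_on UNIV gradV"
    and "v \<in> U" and "R \<ge> 0" and "\<delta> > 0"
    and decrease: "\<And>x. x \<in> \<Omega> \<Longrightarrow> V x \<ge> R \<Longrightarrow> (SUP d\<in>D. gradV x \<bullet> f d x v) \<le> - \<delta>"
    and "a1 \<in> class_K_inf" and "a2 \<in> class_K_inf" and "p > 0"
    and forward: "\<And>x0 d. x0 \<in> \<Omega> \<Longrightarrow> d \<in> Linf_loc D \<Longrightarrow>
      the_solution_satisfies f d (\<lambda>_. v) x0 {0..}
        (\<lambda>x. \<forall>t\<ge>0. x t \<in> \<Omega> \<and> a1 (norm (x t)) \<le> exp (p * t) * a2 (norm x0))"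
    and "r > 0"
  shows "robustly_reachable_const f D U r (\<Omega> \<inter> {x. V x \<le> R}) \<Omega>"
proof -
  let ?A = "\<Omega> \<inter> {x. V x \<le> R}"
  have contV: "continuous_on UNIV V"
    using V_C1(1) unfolding gderiv_def
    by (intro continuous_at_imp_continuous_on ballI) (rule has_derivative_continuous)
  define h where "h = (\<lambda>x. max 0 ((V x - R) / \<delta>))"
  have "continuous_on UNIV h" unfolding h_def using \<open>\<delta> > 0\<close> by (intro continuous_intros contV) auto
  from continuous_radial_majorant[OF this] obtain M where
    M: "continuous_on {0..} M" "mono_on {0..} M" "\<And>x. h x \<le> M (norm x)" "M 0 = h 0" by blast
  \<comment> \<open>Functions of class N vanish at 0, but the waiting time at the origin may be
    positive; \<open>M 0\<close> is therefore split off as the constant \<open>c\<close>.\<close>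
  define c where "c = M 0"
  define b where "b = (\<lambda>s. M s - M 0)"
  have c: "c \<ge> 0" unfolding c_def M(4) by (simp add: h_def)
  have b: "b \<in> class_N"
    using M(1) mono_onD[OF M(2)] unfolding class_N_def b_def
    by (auto intro!: continuous_intros mono_onI)
  have b': "continuous_on {0..} b" "\<And>s t. 0 \<le> s \<Longrightarrow> s \<le> t \<Longrightarrow> b s \<le> b t" "\<And>s. s \<ge> 0 \<Longrightarrow> b s \<ge> 0"
    using b by (auto simp: class_N_def mono_on_def)
  have a2: "\<And>s. s \<ge> 0 \<Longrightarrow> a2 s \<ge> 0" "continuous_on {0..} a2" "a2 0 = 0"
    "\<And>s t. 0 \<le> s \<Longrightarrow> s \<le> t \<Longrightarrow> a2 s \<le> a2 t"
    using \<open>a2 \<in> class_K_inf\<close> strict_mono_on_leD[of "{0..}" a2] by (auto simp: class_K_inf_def)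
  obtain g where g: "continuous_on {0..} g" "mono_on {0..} g" "g 0 = 0"
    "\<And>s. s \<ge> 0 \<Longrightarrow> g s \<ge> 0" "\<And>s. s \<ge> 0 \<Longrightarrow> g (a1 s) = s"
    using class_K_inf_inverse[OF \<open>a1 \<in> class_K_inf\<close>] by blast
  \<comment> \<open>The exponential factor does not vanish at 0; the factor \<open>a2\<close> is
    what makes \<open>E\<close>, and with it \<open>a\<close>, vanish there.\<close>
  define E where "E = (\<lambda>s. exp (p * (c + b s + r)) * a2 s)"
  define a where "a = (\<lambda>s. g (E s))"
  have E: "continuous_on {0..} E" "\<And>s. s \<ge> 0 \<Longrightarrow> E s \<ge> 0" "E 0 = 0"
    "\<And>s t. 0 \<le> s \<Longrightarrow> s \<le> t \<Longrightarrow> E s \<le> E t"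
    unfolding E_def using a2 b' \<open>p > 0\<close> by (auto intro!: continuous_intros mult_mono mult_left_mono)
  have a: "a \<in> class_N"
    unfolding class_N_def
  proof (intro CollectI conjI allI impI)
    show "continuous_on {0..} a"
      unfolding a_def by (rule continuous_on_compose2[OF g(1) E(1)]) (use E in auto)
    show "mono_on {0..} a"
      unfolding a_def using E by (auto intro!: mono_onI mono_onD[OF g(2)])
  qed (use E g in \<open>auto simp: a_def\<close>)
  \<comment> \<open>A real \<open>SUP\<close> dominates the individual values only if they are
    bounded above. (H2) bounds \<open>f d x v\<close> uniformly in \<open>d\<close>, so
    \<open>decrease\<close> yields the inequality for each single \<open>d\<close>.\<close>
  obtain \<alpha> where \<alpha>: "\<And>d x. d \<in> D \<Longrightarrow> norm (f d x v) \<le> \<alpha> (norm x + norm v)"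
    using \<open>H2 f D U\<close> \<open>v \<in> U\<close> unfolding H2_def by blast
  have grad: "f d x v \<bullet> gradV x \<le> - \<delta>" if "d \<in> D" "x \<in> \<Omega>" "V x \<ge> R" for d x
  proof -
    have "gradV x \<bullet> f d' x v \<le> norm (gradV x) * \<alpha> (norm x + norm v)" if "d' \<in> D" for d'
      using Cauchy_Schwarz_ineq2[of "gradV x" "f d' x v"] mult_left_mono[OF \<alpha>[OF that, of x], of "norm (gradV x)"] norm_ge_zero[of "gradV x"]
      by linarith
    then have "bdd_above ((\<lambda>d. gradV x \<bullet> f d x v) ` D)" by (auto intro!: bdd_aboveI2)
    with \<open>d \<in> D\<close> have "gradV x \<bullet> f d x v \<le> (SUP d\<in>D. gradV x \<bullet> f d x v)" by (intro cSUP_upper) auto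
    with decrease[OF that(2,3)] show ?thesis by (simp add: inner_commute)
  qed
  have "\<exists>T\<in>{0..c + b (norm x0)}. the_solution_satisfies f d (\<lambda>_. v) x0 {0..T + r}
      (\<lambda>x. (\<forall>t\<in>{0..T + r}. norm (x t) \<le> a (norm x0)) \<and> (\<forall>t\<in>{T..T + r}. x t \<in> ?A)
        \<and> (\<forall>t\<in>{0..T}. x t \<in> \<Omega>))" if x0: "x0 \<in> \<Omega>" and d: "d \<in> Linf_loc D" for x0 d
  proof -
    have dD: "d t \<in> D" if "t \<ge> 0" for t using d that by (auto simp: Linf_loc_def)
    obtain x where x: "solves f d (\<lambda>_. v) x0 {0..} x"
      and x\<Omega>: "\<And>t. t \<ge> 0 \<Longrightarrow> x t \<in> \<Omega>"
      and xa: "\<And>t. t \<ge> 0 \<Longrightarrow> a1 (norm (x t)) \<le> exp (p * t) * a2 (norm x0)"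
      using forward[OF x0 d] by (auto simp: the_solution_satisfies_def)
    have x_0: "x 0 = x0" using x by (simp add: solves_def)
    define T where "T = h x0"
    have T: "0 \<le> T" "T \<le> c + b (norm x0)" "V x0 - R \<le> \<delta> * T"
      using M(3)[of x0] \<open>\<delta> > 0\<close> by (auto simp: T_def c_def b_def h_def field_simps max_def)
    have bound: "norm (x t) \<le> a (norm x0)" if t: "t \<in> {0..T + r}" for t
    proof -
      have "p * t \<le> p * (c + b (norm x0) + r)" using t T \<open>p > 0\<close> by (intro mult_left_mono) auto
      then have "exp (p * t) * a2 (norm x0) \<le> E (norm x0)"
        unfolding E_def by (intro mult_right_mono a2) auto
      then have "a1 (norm (x t)) \<le> E (norm x0)" using xa[of t] t by auto
      moreover have "a1 (norm (x t)) \<ge> 0" using \<open>a1 \<in> class_K_inf\<close> by (auto simp: class_K_inf_def)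
      ultimately have "g (a1 (norm (x t))) \<le> g (E (norm x0))"
        using E(2) by (intro mono_onD[OF g(2)]) auto
      then show ?thesis using g(5) by (simp add: a_def)
    qed
    \<comment> \<open>The level bound holds at all times from \<open>T\<close> on, so
      \<open>r\<close> affects only the choice of \<open>a\<close>, not that of \<open>c\<close> and
      \<open>b\<close>.\<close>
    have below: "V (x t) \<le> R" if "T \<le> t" for t
    proof (rule decreasing_above_level_trapped[where \<phi> = "\<lambda>t. V (x t)" and T = T])
      have "continuous_on {0..t} x"
        using x T that by (intro abs_cont_on_imp_continuous_on) (auto simp: solves_def)
      then show "continuous_on {0..t} (\<lambda>t. V (x t))" by (auto intro: continuous_on_compose2[OF contV])
      fix s assume s: "0 \<le> s" "s \<le> t" and above: "\<And>\<tau>. \<tau> \<in> {s..t} \<Longrightarrow> R \<le> V (x \<tau>)"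
      have sub: "{s..t} \<subseteq> {0..}" using s by auto
      note xs = solves_on_subinterval[OF x sub, simplified]
      show "V (x t) - V (x s) \<le> - \<delta> * (t - s)"
      proof (rule increment_le_of_gradient_bound[OF s(2) xs(1) V_C1])
        show "AE \<tau> in lebesgue_on {s..t}. \<exists>q. (x has_vector_derivative q) (at \<tau> within {s..t})
            \<and> q \<bullet> gradV (x \<tau>) \<le> - \<delta>"
          using xs(2) AE_space
        proof eventually_elim
          case (elim \<tau>)
          then have "\<tau> \<in> {s..t}" by simp
          then have "f (d \<tau>) (x \<tau>) v \<bullet> gradV (x \<tau>) \<le> - \<delta>"
            using s by (intro grad dD x\<Omega> above) auto
          with elim show ?case by blast
        qed
      qed
    qed (use T that x_0 \<open>\<delta> > 0\<close> in auto)
    have xT: "solves f d (\<lambda>_. v) x0 {0..T + r} x" by (rule solves_subset[OF x]) auto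
    have "(\<forall>t\<in>{0..T + r}. norm (y t) \<le> a (norm x0)) \<and> (\<forall>t\<in>{T..T + r}. y t \<in> ?A)
        \<and> (\<forall>t\<in>{0..T}. y t \<in> \<Omega>)" if y: "solves f d (\<lambda>_. v) x0 {0..T + r} y" for y
    proof -
      have "y t = x t" if "t \<in> {0..T + r}" for t
        by (rule solves_unique[OF \<open>H1 f D U\<close> \<open>v \<in> U\<close> dD y xT that]) simp
      then show ?thesis using bound below x\<Omega> T(1) \<open>r > 0\<close> by simp
    qed
    with xT have "the_solution_satisfies f d (\<lambda>_. v) x0 {0..T + r}
      (\<lambda>x. (\<forall>t\<in>{0..T + r}. norm (x t) \<le> a (norm x0)) \<and> (\<forall>t\<in>{T..T + r}. x t \<in> ?A)
        \<and> (\<forall>t\<in>{0..T}. x t \<in> \<Omega>))"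
      unfolding the_solution_satisfies_def by blast
    moreover have "T \<in> {0..c + b (norm x0)}" using T by simp
    ultimately show ?thesis by blast
  qed
  then show ?thesis
    unfolding robustly_reachable_const_def
    by (intro bexI[OF _ \<open>v \<in> U\<close>] exI[of _ c] conjI c bexI[OF _ a] bexI[OF _ b] ballI)
qed

end
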